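(* Let $A_1,A_2$ be the $6\times6$ matrices over $\mathbb{R}_{\max}$ whose only entries different from $\varepsilon=-\infty$ are the following. For both $s=1,2$: $(A_s)_{1,2}=(A_s)_{2,3}=(A_s)_{3,4}=(A_s)_{4,1}=0$ and $(A_s)_{5,6}=-100$; moreover $(A_1)_{3,5}=(A_1)_{6,4}=-100$ and $(A_2)_{3,5}=(A_2)_{6,4}=-1$. (Their common associated digraph has cyclicity $2$, and their common critical digraph is the cycle $1\to2\to3\to4\to1$, of cyclicity $4$.) Then for every $t\ge2$ none of the products $(A_1)^{4t}\otimes A_2$, $(A_1)^{4t+1}\otimes A_2$, $(A_1)^{4t+2}\otimes A_2$, $(A_1)^{4t+3}\otimes A_2$ is CSR. Consequently, there are arbitrarily long products of matrices from $\{A_1,A_2\}$ that are not CSR.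
   Context: $\mathbb{R}_{\max}=\mathbb{R}\cup\{-\infty\}$ with $a\oplus b=\max(a,b)$, $a\otimes b=a+b$; $(A\otimes B)_{i,j}=\max_l(a_{i,l}+b_{l,j})$; matrix powers are tropical and $A^0=I$ ($0$ on the diagonal, $\varepsilon$ elsewhere). The digraph associated with a square matrix $A$ has an edge $(i,j)$ of weight $a_{i,j}$ iff $a_{i,j}\ne\varepsilon$. The critical digraph of $A$ consists of all nodes and edges on cycles whose mean weight (weight/length) is maximal. The cyclicity of a strongly connected digraph is the gcd of its cycle lengths. CSR: let $\mathcal{E}_c$ be the edge set of the common critical digraph of the matrices in the set, $\gamma$ its cyclicity, $S$ the matrix with $S_{i,j}=0$ for $(i,j)\in\mathcal{E}_c$ and $\varepsilon$ otherwise, $T(S)$ the least $T$ with $S^{l+\gamma}=S^l$ for all $l\ge T$, and $t_0$ any integer with $t_0\gamma\ge T(S)$. For a product $\Gamma(k)$ of $k$ matrices from the set, and $k\,(\mathrm{mod}\,\gamma)\in\{0,\dots,\gamma-1\}$, put $C=\Gamma(k)\otimes S^{(t_0+1)\gamma-k(\mathrm{mod}\,\gamma)}$ and $R=S^{(t_0+1)\gamma-k(\mathrm{mod}\,\gamma)}\otimes\Gamma(k)$. $\Gamma(k)$ is called CSR if $\Gamma(k)=C\otimes S^{k(\mathrm{mod}\,\gamma)}\otimes R$. *)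

theory Defs
  imports "HOL-Analysis.Analysis" "Graph_Theory.Graph_Theory"
begin

section \<open>The max-plus semiring\<close>

datatype rmax = MInf | Fin (fin_val: real)

text \<open>
  The max-plus operations are installed as the semiring operations of \<^typ>\<open>rmax\<close>:
  addition is maximum, multiplication is addition of reals, so that \<open>0\<close> denotes
  minus infinity (\<open>MInf\<close>) and \<open>1\<close> denotes the real number zero. Consequently the
  library's \<open>A ** B\<close> and \<open>mat 1\<close> are the tropical matrix product and identity.
\<close>

instantiation rmax :: comm_semiring_1
begin

definition zero_rmax :: rmax where "0 = MInf"

definition one_rmax :: rmax where "1 = Fin 0"

fun plus_rmax :: "rmax \<Rightarrow> rmax \<Rightarrow> rmax" where
  "MInf + y = y"
| "Fin a + MInf = Fin a"
| "Fin a + Fin b = Fin (max a b)"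

fun times_rmax :: "rmax \<Rightarrow> rmax \<Rightarrow> rmax" where
  "MInf * y = MInf"
| "Fin a * MInf = MInf"
| "Fin a * Fin b = Fin (a + b)"

instance
proof
  fix a b c :: rmax
  show "a * b * c = a * (b * c)" by (cases a; cases b; cases c) auto
  show "a * b = b * a" by (cases a; cases b) auto
  show "a + b + c = a + (b + c)" by (cases a; cases b; cases c) auto
  show "a + b = b + a" by (cases a; cases b) auto
  show "0 + a = a" by (simp add: zero_rmax_def)
  show "1 * a = a" by (cases a) (auto simp: one_rmax_def)
  show "(a + b) * c = a * c + b * c"
    by (cases a; cases b; cases c) (auto simp: max_def)
  show "0 * a = 0" by (simp add: zero_rmax_def)
  show "a * 0 = 0" by (cases a) (auto simp: zero_rmax_def)
  show "(0::rmax) \<noteq> 1" by (simp add: zero_rmax_def one_rmax_def)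
qed

end

type_synonym 'n rmatrix = "rmax ^ 'n ^ 'n"

primrec mpow :: "'n::finite rmatrix \<Rightarrow> nat \<Rightarrow> 'n rmatrix" where
  "mpow A 0 = mat 1"
| "mpow A (Suc k) = A ** mpow A k"

definition mprod :: "'n::finite rmatrix list \<Rightarrow> 'n rmatrix" where
  "mprod As = foldr (**) As (mat 1)"


section \<open>Associated and critical digraphs\<close>

definition assoc_digraph :: "'n::finite rmatrix \<Rightarrow> 'n pair_pre_digraph" where
  "assoc_digraph A = \<lparr> pverts = UNIV, parcs = {(i, j). A $ i $ j \<noteq> MInf} \<rparr>"

text \<open>
  Cycles are the elementary cycles of the library, given by their lists of arcs; loops count
  as cycles of length one. The maximal cycle mean, the nodes and edges it is attained on, and
  the gcd of the cycle lengths are the same as for arbitrary nonempty closed walks.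
\<close>

definition is_cycle :: "'n pair_pre_digraph \<Rightarrow> ('n \<times> 'n) list \<Rightarrow> bool" where
  "is_cycle D p \<longleftrightarrow> pre_digraph.cycle (with_proj D) p"

text \<open>Only meant for lists of edges of \<open>assoc_digraph A\<close>, whose entries are all finite.\<close>

definition mean_weight :: "'n::finite rmatrix \<Rightarrow> ('n \<times> 'n) list \<Rightarrow> real" where
  "mean_weight A p = (\<Sum>(i, j)\<leftarrow>p. fin_val (A $ i $ j)) / real (length p)"

definition critical_cycle :: "'n::finite rmatrix \<Rightarrow> ('n \<times> 'n) list \<Rightarrow> bool" where
  "critical_cycle A p \<longleftrightarrow> is_cycle (assoc_digraph A) p \<and>
     (\<forall>q. is_cycle (assoc_digraph A) q \<longrightarrow> mean_weight A q \<le> mean_weight A p)"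

definition critical_digraph :: "'n::finite rmatrix \<Rightarrow> 'n pair_pre_digraph" where
  "critical_digraph A =
     \<lparr> pverts = {i. \<exists>p. critical_cycle A p \<and> i \<in> fst ` set p},
       parcs = {e. \<exists>p. critical_cycle A p \<and> e \<in> set p} \<rparr>"

text \<open>Only meant for strongly connected digraphs.\<close>

definition cyclicity :: "'n pair_pre_digraph \<Rightarrow> nat" where
  "cyclicity D = Gcd {length p | p. is_cycle D p}"


section \<open>CSR products\<close>

text \<open>Only meant for nonempty sets of matrices that all have the same critical digraph.\<close>

definition common_critical_digraph :: "'n::finite rmatrix set \<Rightarrow> 'n pair_pre_digraph" where
  "common_critical_digraph X = (THE D. \<forall>A\<in>X. critical_digraph A = D)"

definition csr_gamma :: "'n::finite rmatrix set \<Rightarrow> nat" where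
  "csr_gamma X = cyclicity (common_critical_digraph X)"

definition csr_S :: "'n::finite rmatrix set \<Rightarrow> 'n rmatrix" where
  "csr_S X = (\<chi> i j. if (i, j) \<in> parcs (common_critical_digraph X) then Fin 0 else MInf)"

definition csr_T :: "'n::finite rmatrix set \<Rightarrow> nat" where
  "csr_T X = (LEAST T. \<forall>l\<ge>T. mpow (csr_S X) (l + csr_gamma X) = mpow (csr_S X) l)"

definition admissible_t0 :: "'n::finite rmatrix set \<Rightarrow> nat \<Rightarrow> bool" where
  "admissible_t0 X t0 \<longleftrightarrow> t0 * csr_gamma X \<ge> csr_T X"

text \<open>
  In the next three definitions \<open>G\<close> is meant to be a product of \<open>k\<close> matrices from \<open>X\<close>.
  The subtraction in the exponent never truncates when \<open>csr_gamma X > 0\<close>.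
\<close>

definition csr_C :: "'n::finite rmatrix set \<Rightarrow> nat \<Rightarrow> nat \<Rightarrow> 'n rmatrix \<Rightarrow> 'n rmatrix" where
  "csr_C X t0 k G = G ** mpow (csr_S X) ((t0 + 1) * csr_gamma X - k mod csr_gamma X)"

definition csr_R :: "'n::finite rmatrix set \<Rightarrow> nat \<Rightarrow> nat \<Rightarrow> 'n rmatrix \<Rightarrow> 'n rmatrix" where
  "csr_R X t0 k G = mpow (csr_S X) ((t0 + 1) * csr_gamma X - k mod csr_gamma X) ** G"

definition is_CSR :: "'n::finite rmatrix set \<Rightarrow> nat \<Rightarrow> nat \<Rightarrow> 'n rmatrix \<Rightarrow> bool" where
  "is_CSR X t0 k G \<longleftrightarrow>
     G = csr_C X t0 k G ** mpow (csr_S X) (k mod csr_gamma X) ** csr_R X t0 k G"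


section \<open>The two matrices\<close>

text \<open>The elements of the index type \<open>6\<close> are \<open>1, 2, 3, 4, 5\<close> and \<open>6\<close> (which equals \<open>0\<close> there).\<close>

definition ex_matrix :: "real \<Rightarrow> 6 rmatrix" where
  "ex_matrix w = (\<chi> i j.
     if (i, j) \<in> {(1, 2), (2, 3), (3, 4), (4, 1)} then Fin 0
     else if (i, j) = (5, 6) then Fin (-100)
     else if (i, j) \<in> {(3, 5), (6, 4)} then Fin w
     else MInf)"

definition A1 :: "6 rmatrix" where "A1 = ex_matrix (-100)"

definition A2 :: "6 rmatrix" where "A2 = ex_matrix (-1)"

end

(* The entries of the product of A1^m with A2 are maximal weights of walks of length k = m + 1 that
   take only their last step in A2, so a cheap edge of weight -1 can be used once in the product,
   but twice in the CSR expression. The detour 3 -> 5 -> 6 -> 4 shifts the phase modulo 4 by two.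
   For i = 2 - k (mod 4), a walk of length k from i to 5 must make this detour at the full price of
   -300 before it leaves to 5 at price -1, which gives weight -301. In the CSR expression the first factor may go from i to 4
   by way of 5 and 6 for -201, finishing with the cheap edge 6 -> 4 of A2, and the last factor may
   end with the cheap edge 3 -> 5, for a total of -202. *)
theory Submission
  imports Defs
begin

section \<open>Matrices over the max-plus semiring\<close>

lemma rmax_plus_MInf [simp]: "x + MInf = x"
  by (cases x) auto

lemma rmax_times_MInf [simp]: "x * MInf = MInf"
  by (cases x) auto

lemma rmax_Fin_0_times [simp]: "Fin 0 * x = x"
  by (cases x) auto

text \<open>A lower bound by a finite value; it stands in for an order on \<^typ>\<open>rmax\<close>.\<close>

definition at_least :: "real \<Rightarrow> rmax \<Rightarrow> bool" where
  "at_least c x \<longleftrightarrow> (\<exists>y. x = Fin y \<and> c \<le> y)"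

lemma at_least_Fin [simp]: "at_least c (Fin y) \<longleftrightarrow> c \<le> y"
  by (simp add: at_least_def)

lemma at_least_plus1: "at_least c x \<Longrightarrow> at_least c (x + y)"
  by (cases x; cases y) (auto simp: at_least_def)

lemma at_least_plus2: "at_least c y \<Longrightarrow> at_least c (x + y)"
  by (cases x; cases y) (auto simp: at_least_def)

lemma at_least_times: "at_least c x \<Longrightarrow> at_least d y \<Longrightarrow> at_least (c + d) (x * y)"
  by (cases x; cases y) (auto simp: at_least_def)

lemma at_least_sum:
  assumes "finite I" "i \<in> I" "at_least c (f i)"
  shows "at_least c (sum f I)"
  using assms by (simp add: sum.remove at_least_plus1)

text \<open>A single walk through \<open>l\<close> already bounds the entry from below, so lower
  bounds need no full matrix product.\<close>

lemma at_least_matrix_mult: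
  fixes A B :: "'n::finite rmatrix"
  assumes "at_least c (A $ i $ l)" "at_least d (B $ l $ j)"
  shows "at_least (c + d) ((A ** B) $ i $ j)"
  using assms
  by (auto simp: matrix_matrix_mult_def intro: at_least_sum[of UNIV l] at_least_times)

lemma mpow_add: "mpow A (m + n) = mpow A m ** mpow A n"
  by (induction m) (simp_all add: matrix_mul_assoc)

text \<open>Exposes one turn of the critical cycle, so that the row rules for \<open>S_ex\<close>
  and \<open>A1\<close> rewrite a whole period.\<close>

lemma mpow_add_4: "mpow A (4 + n) = A ** (A ** (A ** (A ** mpow A n)))"
  by (simp add: numeral_eq_Suc)

lemma mprod_append_single: "mprod (replicate n A @ [B]) = mpow A n ** B"
  by (induction n) (simp_all add: mprod_def matrix_mul_assoc)


section \<open>The index type\<close>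

lemma exhaust_6:
  fixes x :: 6
  shows "x = 1 \<or> x = 2 \<or> x = 3 \<or> x = 4 \<or> x = 5 \<or> x = 6"
proof (induct x)
  case (of_int z)
  then have "z = 0 \<or> z = 1 \<or> z = 2 \<or> z = 3 \<or> z = 4 \<or> z = 5" by fastforce
  then show ?case by auto
qed

lemma forall_6: "(\<forall>i::6. P i) \<longleftrightarrow> P 1 \<and> P 2 \<and> P 3 \<and> P 4 \<and> P 5 \<and> P 6"
  by (metis exhaust_6)

lemma UNIV_6: "UNIV = {1, 2, 3, 4, 5, 6 :: 6}"
  using exhaust_6 by auto

lemma sum_6: "sum f (UNIV :: 6 set) = f 1 + f 2 + f 3 + f 4 + f 5 + f 6"
  unfolding UNIV_6 by (simp add: ac_simps)


section \<open>Cycles\<close>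

lemma is_cycle_iff:
  "is_cycle D p \<longleftrightarrow> (\<exists>u. u \<in> pverts D \<and> set p \<subseteq> parcs D \<and> pcas u p u \<and>
     distinct (tl (pawalk_verts u p)) \<and> p \<noteq> [])"
  by (auto simp: is_cycle_def pre_digraph.cycle_def pre_digraph.awalk_def
      cas_with_proj_eq awalk_verts_with_proj_eq)

text \<open>\<open>f\<close> is a phase that advances by one modulo \<open>g\<close> along every
  edge, so a walk advances it by its length.\<close>

lemma pcas_phase:
  fixes f :: "'a \<Rightarrow> int"
  assumes "pcas u p v" "\<forall>(i, j)\<in>set p. f j mod g = (f i + 1) mod g"
  shows "f v mod g = (f u + int (length p)) mod g"
  using assms
proof (induction p arbitrary: u)
  case (Cons e p)
  obtain j where e: "e = (u, j)" using Cons.prems by (cases e) auto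
  have "f v mod g = (f j + int (length p)) mod g"
    using Cons e by simp
  also have "\<dots> = ((f u + 1) + int (length p)) mod g"
    using Cons.prems(2) e by (intro mod_add_cong) auto
  finally show ?case by (simp add: ac_simps)
qed simp

text \<open>A closed walk returns to the phase it started from.\<close>

lemma phase_dvd_cycle_length:
  fixes f :: "'a \<Rightarrow> int"
  assumes "\<forall>(i, j)\<in>parcs D. f j mod int g = (f i + 1) mod int g" "is_cycle D p"
  shows "g dvd length p"
proof -
  obtain u where "pcas u p u" "set p \<subseteq> parcs D"
    using assms(2) by (auto simp: is_cycle_iff)
  then have "f u mod int g = (f u + int (length p)) mod int g"
    using assms(1) by (intro pcas_phase) auto
  then have "int g dvd int (length p)"
    by (metis add_diff_cancel_left' mod_eq_dvd_iff)
  then show ?thesis by simp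
qed

lemma cyclicity_dvd_length: "is_cycle D p \<Longrightarrow> cyclicity D dvd length p"
  unfolding cyclicity_def by (rule Gcd_dvd) blast

text \<open>Gives a divisor of the cyclicity without listing all cycles; explicit cycles give the
  multiples.\<close>

lemma phase_dvd_cyclicity:
  fixes f :: "'a \<Rightarrow> int"
  assumes "\<forall>(i, j)\<in>parcs D. f j mod int g = (f i + 1) mod int g"
  shows "g dvd cyclicity D"
  unfolding cyclicity_def
  by (rule Gcd_greatest) (auto dest: phase_dvd_cycle_length[OF assms])

lemma strongly_connected_hub:
  assumes "wf_digraph G" "h \<in> verts G"
    and "\<And>v. v \<in> verts G \<Longrightarrow> h \<rightarrow>\<^sup>*\<^bsub>G\<^esub> v \<and> v \<rightarrow>\<^sup>*\<^bsub>G\<^esub> h"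
  shows "strongly_connected G"
  using assms by (auto intro!: strongly_connectedI intro: wf_digraph.reachable_trans)


lemma sum_list_nonpos_eq_0_iff:
  fixes xs :: "'a::ordered_ab_group_add list"
  assumes "\<And>x. x \<in> set xs \<Longrightarrow> x \<le> 0"
  shows "sum_list xs = 0 \<longleftrightarrow> (\<forall>x\<in>set xs. x = 0)"
  using assms by (induction xs) (simp_all add: add_nonpos_eq_0_iff sum_list_nonpos)


section \<open>The digraphs of the two matrices\<close>

abbreviation four_cycle :: "(6 \<times> 6) list" where
  "four_cycle \<equiv> [(1, 2), (2, 3), (3, 4), (4, 1)]"

abbreviation six_cycle :: "(6 \<times> 6) list" where
  "six_cycle \<equiv> [(1, 2), (2, 3), (3, 5), (5, 6), (6, 4), (4, 1)]"

abbreviation critical_ex :: "6 pair_pre_digraph" where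
  "critical_ex \<equiv> \<lparr> pverts = {1, 2, 3, 4}, parcs = {(1, 2), (2, 3), (3, 4), (4, 1)} \<rparr>"

lemma assoc_digraph_ex_matrix:
  "assoc_digraph (ex_matrix w) =
     \<lparr> pverts = UNIV, parcs = {(1, 2), (2, 3), (3, 4), (4, 1), (5, 6), (3, 5), (6, 4)} \<rparr>"
  by (auto simp: assoc_digraph_def ex_matrix_def split: if_splits)

lemma is_cycle_four_cycle: "is_cycle (assoc_digraph (ex_matrix w)) four_cycle"
  by (auto simp: is_cycle_iff assoc_digraph_ex_matrix)

lemma is_cycle_six_cycle: "is_cycle (assoc_digraph (ex_matrix w)) six_cycle"
  by (auto simp: is_cycle_iff assoc_digraph_ex_matrix)

lemma strongly_connected_assoc_ex:
  "strongly_connected (with_proj (assoc_digraph (ex_matrix w)))" (is "strongly_connected ?G")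
proof -
  interpret wf_digraph ?G
    by unfold_locales (auto simp: assoc_digraph_ex_matrix)
  have adj: "1 \<rightarrow>\<^sup>*\<^bsub>?G\<^esub> 2" "2 \<rightarrow>\<^sup>*\<^bsub>?G\<^esub> 3" "3 \<rightarrow>\<^sup>*\<^bsub>?G\<^esub> 4" "4 \<rightarrow>\<^sup>*\<^bsub>?G\<^esub> 1"
    "3 \<rightarrow>\<^sup>*\<^bsub>?G\<^esub> 5" "5 \<rightarrow>\<^sup>*\<^bsub>?G\<^esub> 6" "6 \<rightarrow>\<^sup>*\<^bsub>?G\<^esub> 4"
    by (rule reachable_adjI, simp add: assoc_digraph_ex_matrix)+
  have "\<forall>v. 1 \<rightarrow>\<^sup>*\<^bsub>?G\<^esub> v \<and> v \<rightarrow>\<^sup>*\<^bsub>?G\<^esub> 1"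
    unfolding forall_6 using adj by (meson reachable_trans)
  then show ?thesis
    by (intro strongly_connected_hub[of _ 1] wf_digraph_axioms)
      (auto simp: assoc_digraph_ex_matrix)
qed

lemma cyclicity_assoc_ex: "cyclicity (assoc_digraph (ex_matrix w)) = 2"
proof (rule dvd_antisym)
  have "cyclicity (assoc_digraph (ex_matrix w)) dvd 4"
    using cyclicity_dvd_length[OF is_cycle_four_cycle[of w]] by (simp add: numeral_eq_Suc)
  moreover have "cyclicity (assoc_digraph (ex_matrix w)) dvd 6"
    using cyclicity_dvd_length[OF is_cycle_six_cycle[of w]] by (simp add: numeral_eq_Suc)
  ultimately have "cyclicity (assoc_digraph (ex_matrix w)) dvd 6 - 4"
    by (rule dvd_diff_nat[rotated])
  then show "cyclicity (assoc_digraph (ex_matrix w)) dvd 2" by simp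
  show "2 dvd cyclicity (assoc_digraph (ex_matrix w))"
    \<comment> \<open>Every edge joins the classes 1, 3, 6 and 2, 4, 5, so the digraph is
      bipartite.\<close>
    by (rule phase_dvd_cyclicity[where f = "\<lambda>i. if i \<in> {1, 3, 6} then 0 else 1"])
      (simp add: assoc_digraph_ex_matrix)
qed

section \<open>Critical cycles and the critical digraph\<close>

lemma mean_weight_four_cycle: "mean_weight (ex_matrix w) four_cycle = 0"
  by (simp add: mean_weight_def ex_matrix_def)

text \<open>All weights are at most 0, with equality exactly on the edges of
  \<open>four_cycle\<close>. Hence the maximal cycle mean is 0, and a cycle attains it iff it uses
  no other edge.\<close>

lemma critical_cycle_ex_iff:
  assumes "w < 0"
  shows "critical_cycle (ex_matrix w) p \<longleftrightarrow>
    is_cycle (assoc_digraph (ex_matrix w)) p \<and> set p \<subseteq> set four_cycle"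
proof -
  let ?D = "assoc_digraph (ex_matrix w)"
  let ?g = "\<lambda>e. fin_val (ex_matrix w $ fst e $ snd e)"
  have weight: "?g e \<le> 0" "?g e = 0 \<longleftrightarrow> e \<in> set four_cycle" if "e \<in> parcs ?D" for e
  proof -
    have "e = (1, 2) \<or> e = (2, 3) \<or> e = (3, 4) \<or> e = (4, 1) \<or>
        e = (5, 6) \<or> e = (3, 5) \<or> e = (6, 4)"
      using that by (simp add: assoc_digraph_ex_matrix)
    then show "?g e \<le> 0" "?g e = 0 \<longleftrightarrow> e \<in> set four_cycle"
      using assms by (elim disjE; simp add: ex_matrix_def)+
  qed
  have mean: "mean_weight (ex_matrix w) q \<le> 0"
    "mean_weight (ex_matrix w) q = 0 \<longleftrightarrow> set q \<subseteq> set four_cycle" if "is_cycle ?D q" for q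
  proof -
    have q: "set q \<subseteq> parcs ?D" "q \<noteq> []"
      using that by (auto simp: is_cycle_iff)
    have eq: "mean_weight (ex_matrix w) q = sum_list (map ?g q) / real (length q)"
      by (simp add: mean_weight_def case_prod_unfold)
    have le: "sum_list (map ?g q) \<le> 0"
      using q weight(1) by (intro sum_list_nonpos) auto
    then show "mean_weight (ex_matrix w) q \<le> 0"
      by (simp add: eq divide_nonpos_nonneg)
    have "sum_list (map ?g q) = 0 \<longleftrightarrow> (\<forall>x\<in>set (map ?g q). x = 0)"
      using q weight(1) by (intro sum_list_nonpos_eq_0_iff) auto
    also have "\<dots> \<longleftrightarrow> (\<forall>e\<in>set q. ?g e = 0)" by simp
    also have "\<dots> \<longleftrightarrow> (\<forall>e\<in>set q. e \<in> set four_cycle)"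
      using q weight(2) by (intro ball_cong) auto
    finally show "mean_weight (ex_matrix w) q = 0 \<longleftrightarrow> set q \<subseteq> set four_cycle"
      using q(2) by (simp add: eq subset_eq)
  qed
  show ?thesis
    unfolding critical_cycle_def
    using mean is_cycle_four_cycle[of w] mean_weight_four_cycle[of w] by (metis order_antisym)
qed

text \<open>The critical cycles need not be enumerated: \<open>four_cycle\<close> covers its own
  edges, and no critical cycle has others.\<close>

lemma critical_digraph_ex:
  assumes "w < 0"
  shows "critical_digraph (ex_matrix w) = critical_ex"
proof -
  have "critical_cycle (ex_matrix w) four_cycle"
    using assms by (simp add: critical_cycle_ex_iff is_cycle_four_cycle)
  then have "\<exists>p. critical_cycle (ex_matrix w) p \<and> e \<in> set p" if "e \<in> set four_cycle" for e
    using that by blast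
  then have arcs: "(\<exists>p. critical_cycle (ex_matrix w) p \<and> e \<in> set p) \<longleftrightarrow> e \<in> set four_cycle" for e
    using critical_cycle_ex_iff[OF assms] by blast
  have "(\<exists>p. critical_cycle (ex_matrix w) p \<and> i \<in> fst ` set p) \<longleftrightarrow> i \<in> fst ` set four_cycle" for i
    using arcs by blast
  with arcs show ?thesis
    by (auto simp: critical_digraph_def)
qed

lemma critical_digraph_A1: "critical_digraph A1 = critical_ex"
  and critical_digraph_A2: "critical_digraph A2 = critical_ex"
  by (simp_all add: A1_def A2_def critical_digraph_ex)

lemma common_critical_digraph_ex: "common_critical_digraph {A1, A2} = critical_ex"
  by (simp add: common_critical_digraph_def critical_digraph_A1 critical_digraph_A2)

lemma strongly_connected_critical_ex:
  "strongly_connected (with_proj critical_ex)" (is "strongly_connected ?G")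
proof -
  interpret wf_digraph ?G
    by unfold_locales auto
  have adj: "1 \<rightarrow>\<^sup>*\<^bsub>?G\<^esub> 2" "2 \<rightarrow>\<^sup>*\<^bsub>?G\<^esub> 3" "3 \<rightarrow>\<^sup>*\<^bsub>?G\<^esub> 4" "4 \<rightarrow>\<^sup>*\<^bsub>?G\<^esub> 1"
    by (rule reachable_adjI, simp)+
  have "\<forall>v\<in>{1, 2, 3, 4}. 1 \<rightarrow>\<^sup>*\<^bsub>?G\<^esub> v \<and> v \<rightarrow>\<^sup>*\<^bsub>?G\<^esub> 1"
    unfolding ball_simps using adj by (meson reachable_trans)
  then show ?thesis
    by (intro strongly_connected_hub[of _ 1] wf_digraph_axioms) auto
qed

lemma cyclicity_critical_ex: "cyclicity critical_ex = 4"
proof (rule dvd_antisym)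
  have "is_cycle critical_ex four_cycle"
    by (auto simp: is_cycle_iff)
  from cyclicity_dvd_length[OF this] show "cyclicity critical_ex dvd 4"
    by (simp add: numeral_eq_Suc)
  show "4 dvd cyclicity critical_ex"
    \<comment> \<open>The phase is the position on the cycle; the edge from 4 to 1 wraps around
      modulo 4.\<close>
    by (rule phase_dvd_cyclicity
        [where f = "\<lambda>i. if i = 1 then 1 else if i = 2 then 2 else if i = 3 then 3 else 4"]) simp
qed


section \<open>The products\<close>

abbreviation S_ex :: "6 rmatrix" where
  "S_ex \<equiv> csr_S {A1, A2}"

lemma S_ex_entry: "S_ex $ i $ j = (if (i, j) \<in> set four_cycle then Fin 0 else MInf)"
  by (simp add: csr_S_def common_critical_digraph_ex)

lemma csr_gamma_ex: "csr_gamma {A1, A2} = 4"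
  by (simp add: csr_gamma_def common_critical_digraph_ex cyclicity_critical_ex)

text \<open>Each critical row of \<open>S_ex\<close> has one finite entry, at the successor on the
  cycle, so multiplication shifts rows.\<close>

lemma S_ex_mult:
  "(S_ex ** M) $ 1 $ j = M $ 2 $ j" "(S_ex ** M) $ 2 $ j = M $ 3 $ j"
  "(S_ex ** M) $ 3 $ j = M $ 4 $ j" "(S_ex ** M) $ 4 $ j = M $ 1 $ j"
  by (simp_all add: matrix_matrix_mult_def sum_6 S_ex_entry)

text \<open>Row 4 matters because the cheap edge from 6 enters the critical cycle at 4.\<close>

lemma S_ex_period: "mpow S_ex (4 * q + s) $ 4 $ j = mpow S_ex s $ 4 $ j"
  by (induction q) (simp_all add: add.assoc mpow_add_4 S_ex_mult)

lemma S_ex_row_4: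
  "mpow S_ex 0 $ 4 $ 4 = Fin 0" "mpow S_ex 1 $ 4 $ 1 = Fin 0"
  "mpow S_ex 2 $ 4 $ 2 = Fin 0" "mpow S_ex 3 $ 4 $ 3 = Fin 0"
  by (simp_all add: numeral_eq_Suc S_ex_mult mat_def one_rmax_def)

section \<open>Powers of \<open>A1\<close> followed by one step in \<open>A2\<close>\<close>

lemma A1_mult:
  "(A1 ** M) $ 1 $ j = M $ 2 $ j" "(A1 ** M) $ 2 $ j = M $ 3 $ j"
  "(A1 ** M) $ 3 $ j = M $ 4 $ j + Fin (-100) * M $ 5 $ j" "(A1 ** M) $ 4 $ j = M $ 1 $ j"
  "(A1 ** M) $ 5 $ j = Fin (-100) * M $ 6 $ j" "(A1 ** M) $ 6 $ j = Fin (-100) * M $ 4 $ j"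
  by (simp_all add: matrix_matrix_mult_def sum_6 A1_def ex_matrix_def)

text \<open>Columns 4 and 5 are those entered by the cheap edges.\<close>

lemma mult_A2:
  "(M ** A2) $ i $ 4 = M $ i $ 3 + M $ i $ 6 * Fin (-1)"
  "(M ** A2) $ i $ 5 = M $ i $ 3 * Fin (-1)"
  by (simp_all add: matrix_matrix_mult_def sum_6 A2_def ex_matrix_def mult.commute[of _ "Fin 0"])

text \<open>The column is periodic only from the eighth power on, which is where \<open>2 \<le> t\<close> enters.\<close>

lemma A1_pow_column_3:
  assumes "2 \<le> t"
  shows "mpow A1 (4 * t) $ 1 $ 3 = Fin (-300) \<and> mpow A1 (4 * t) $ 2 $ 3 = MInf \<and>
    mpow A1 (4 * t) $ 3 $ 3 = Fin 0 \<and> mpow A1 (4 * t) $ 4 $ 3 = MInf \<and>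
    mpow A1 (4 * t) $ 5 $ 3 = MInf \<and> mpow A1 (4 * t) $ 6 $ 3 = Fin (-100)"
  using assms
proof (induction t rule: dec_induct)
  case base
  show ?case by (simp add: numeral_eq_Suc A1_mult mat_def zero_rmax_def one_rmax_def)
next
  case (step t)
  then show ?case by (simp add: mpow_add_4 A1_mult)
qed

text \<open>Turns of the critical cycle, then the walk 1, 2, 3, 5, 6 of weight -200.\<close>

lemma A1_pow_1_6:
  assumes "2 \<le> t"
  shows "at_least (-200) (mpow A1 (4 * t) $ 1 $ 6)"
  using assms
proof (induction t rule: dec_induct)
  case base
  show ?case by (simp add: numeral_eq_Suc A1_mult mat_def zero_rmax_def one_rmax_def)
next
  case (step t)
  then show ?case by (simp add: mpow_add_4 A1_mult at_least_plus1)
qed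

text \<open>Compares the entries at \<open>i\<close>, 5. The CSR side allows -201 from
  \<open>i\<close> to 4, then 0 along the cycle to \<open>b\<close>, then -1 from \<open>b\<close>
  to 5. The node \<open>b\<close> lies \<open>s\<close> steps past 4, and the total exponent of
  \<open>S_ex\<close> is congruent to \<open>s\<close> modulo 4.\<close>

lemma not_is_CSR_ex:
  assumes "at_least (-200) (mpow A1 m $ i $ 6)" "mpow A1 m $ i $ 3 = Fin (-300)"
    and "mpow A1 m $ b $ 3 = Fin 0"
    and S: "mpow S_ex s $ 4 $ b = Fin 0" and s: "4 dvd k mod 4 + s"
    and le: "s \<le> 4 * (2 * t0 + 2) - k mod 4"
  shows "\<not> is_CSR {A1, A2} t0 k (mpow A1 m ** A2)"
proof
  define G where "G = mpow A1 m ** A2"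
  define r where "r = k mod 4"
  define n where "n = (t0 + 1) * 4"
  have r: "r < 4" by (simp add: r_def)
  assume "is_CSR {A1, A2} t0 k (mpow A1 m ** A2)"
  then have "G = (G ** mpow S_ex (n - r)) ** mpow S_ex r ** (mpow S_ex (n - r) ** G)"
    by (simp add: is_CSR_def csr_C_def csr_R_def csr_gamma_ex G_def r_def n_def)
  also have "\<dots> = G ** mpow S_ex ((n - r) + r + (n - r)) ** G"
    by (simp add: mpow_add matrix_mul_assoc)
  finally have G_eq: "G = G ** mpow S_ex ((n - r) + r + (n - r)) ** G" .
  obtain c where c: "r + s = 4 * c" using s by (auto simp: r_def)
  \<comment> \<open>The left side is \<open>2 * n - r\<close>; by \<open>le\<close>,
    \<open>c\<close> is at most \<open>2 * t0 + 2\<close>, so no subtraction truncates.\<close>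
  have "(n - r) + r + (n - r) = 4 * (2 * t0 + 2 - c) + s"
    using r c le by (simp add: n_def r_def)
  then have "at_least 0 (mpow S_ex ((n - r) + r + (n - r)) $ 4 $ b)"
    using S by (simp only: S_ex_period) simp
  moreover have "at_least (-201) (G $ i $ 4)"
    using at_least_times[OF assms(1), of "-1" "Fin (-1)"]
    by (simp add: G_def mult_A2 at_least_plus2)
  moreover have "at_least (-1) (G $ b $ 5)"
    using assms(3) by (simp add: G_def mult_A2)
  ultimately have "at_least (-201 + 0 + -1) ((G ** mpow S_ex ((n - r) + r + (n - r)) ** G) $ i $ 5)"
    by (intro at_least_matrix_mult)
  then have "at_least (-202) (G $ i $ 5)"
    using G_eq by simp
  \<comment> \<open>Only node 3 has an edge to 5, so the entry is exactly -300 - 1.\<close>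
  moreover have "G $ i $ 5 = Fin (-301)"
    using assms(2) by (simp add: G_def mult_A2)
  ultimately show False by simp
qed

text \<open>Each further factor \<open>A1\<close> moves the starting nodes \<open>i\<close> and
  \<open>b\<close> one step back along the critical cycle. For \<open>i = 3\<close> the detour can
  also start at once, again at total weight -300.\<close>

lemma not_is_CSR_products:
  assumes "2 \<le> t"
  shows "\<not> is_CSR {A1, A2} t0 (4 * t + 1) (mpow A1 (4 * t) ** A2)"
    and "\<not> is_CSR {A1, A2} t0 (4 * t + 2) (mpow A1 (4 * t + 1) ** A2)"
    and "\<not> is_CSR {A1, A2} t0 (4 * t + 3) (mpow A1 (4 * t + 2) ** A2)"
    and "\<not> is_CSR {A1, A2} t0 (4 * t + 4) (mpow A1 (4 * t + 3) ** A2)"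
proof -
  note col = A1_pow_column_3[OF assms] A1_pow_1_6[OF assms]
  have mods: "(4 * t + 1) mod 4 = 1" "(4 * t + 2) mod 4 = 2" "(4 * t + 3) mod 4 = 3"
    "(4 * t + 4) mod 4 = 0"
    by presburger+
  have two: "mpow A1 (4 * t + 2) = A1 ** mpow A1 (4 * t + 1)"
    and three: "mpow A1 (4 * t + 3) = A1 ** mpow A1 (4 * t + 2)"
    by (simp_all add: numeral_eq_Suc)
  show "\<not> is_CSR {A1, A2} t0 (4 * t + 1) (mpow A1 (4 * t) ** A2)"
    by (rule not_is_CSR_ex[where i = 1 and b = 3 and s = 3]) (use col S_ex_row_4 mods in simp_all)
  show "\<not> is_CSR {A1, A2} t0 (4 * t + 2) (mpow A1 (4 * t + 1) ** A2)"
    by (rule not_is_CSR_ex[where i = 4 and b = 2 and s = 2])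
      (use col S_ex_row_4 mods in \<open>simp_all add: A1_mult\<close>)
  show "\<not> is_CSR {A1, A2} t0 (4 * t + 3) (mpow A1 (4 * t + 2) ** A2)"
    by (rule not_is_CSR_ex[where i = 3 and b = 1 and s = 1])
      (use col S_ex_row_4 mods in \<open>simp_all add: A1_mult at_least_plus1 two\<close>)
  show "\<not> is_CSR {A1, A2} t0 (4 * t + 4) (mpow A1 (4 * t + 3) ** A2)"
    by (rule not_is_CSR_ex[where i = 2 and b = 4 and s = 0])
      (use col S_ex_row_4 mods in \<open>simp_all add: A1_mult at_least_plus1 three\<close>)
qed

text \<open>The length passed to \<open>is_CSR\<close> counts the final factor \<open>A2\<close>,
  hence \<open>4 * t + 1\<close> for the power \<open>4 * t\<close>. Strong connectivity is stated
  because \<open>cyclicity\<close> is meant for such digraphs.\<close>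

theorem mainTheorem5:
  shows
    "assoc_digraph A1 = assoc_digraph A2 \<and>
     strongly_connected (with_proj (assoc_digraph A1)) \<and>
     cyclicity (assoc_digraph A1) = 2 \<and>
     (\<forall>A\<in>{A1, A2}. critical_digraph A =
        \<lparr> pverts = {1, 2, 3, 4}, parcs = {(1, 2), (2, 3), (3, 4), (4, 1)} \<rparr>) \<and>
     strongly_connected (with_proj (common_critical_digraph {A1, A2})) \<and>
     cyclicity (common_critical_digraph {A1, A2}) = 4 \<and>
     (\<forall>t\<ge>2. \<forall>t0. admissible_t0 {A1, A2} t0 \<longrightarrow>
        \<not> is_CSR {A1, A2} t0 (4 * t + 1) (mpow A1 (4 * t) ** A2) \<and>
        \<not> is_CSR {A1, A2} t0 (4 * t + 2) (mpow A1 (4 * t + 1) ** A2) \<and>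
        \<not> is_CSR {A1, A2} t0 (4 * t + 3) (mpow A1 (4 * t + 2) ** A2) \<and>
        \<not> is_CSR {A1, A2} t0 (4 * t + 4) (mpow A1 (4 * t + 3) ** A2)) \<and>
     (\<forall>N. \<exists>As. set As \<subseteq> {A1, A2} \<and> N \<le> length As \<and>
        (\<forall>t0. admissible_t0 {A1, A2} t0 \<longrightarrow>
           \<not> is_CSR {A1, A2} t0 (length As) (mprod As)))"
proof -
  have long: "\<exists>As. set As \<subseteq> {A1, A2} \<and> N \<le> length As \<and>
      (\<forall>t0. admissible_t0 {A1, A2} t0 \<longrightarrow> \<not> is_CSR {A1, A2} t0 (length As) (mprod As))" for N
  proof (intro exI conjI allI impI)
    \<comment> \<open>Taking \<open>N + 2\<close> turns makes the product long enough and meets the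
      bound \<open>2 \<le> t\<close> for every \<open>N\<close>.\<close>
    let ?As = "replicate (4 * (N + 2)) A1 @ [A2]"
    show "set ?As \<subseteq> {A1, A2}" "N \<le> length ?As" by auto
    show "\<not> is_CSR {A1, A2} t0 (length ?As) (mprod ?As)" for t0
      using not_is_CSR_products(1)[of "N + 2" t0] by (simp only: mprod_append_single) simp
  qed
  have "assoc_digraph A1 = assoc_digraph A2" "strongly_connected (with_proj (assoc_digraph A1))"
    "cyclicity (assoc_digraph A1) = 2"
    unfolding A1_def A2_def
    by (rule trans[OF assoc_digraph_ex_matrix assoc_digraph_ex_matrix[symmetric]]
        strongly_connected_assoc_ex cyclicity_assoc_ex)+
  then show ?thesis
    using not_is_CSR_products long
    by (simp only: common_critical_digraph_ex critical_digraph_A1 critical_digraph_A2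
        strongly_connected_critical_ex cyclicity_critical_ex ball_simps) blast
qed

end
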